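(* Let $m,n\in\mathbf{N}$. If a set family $\mathcal{P}$ of shape $(m^n)$ and type $\lambda$ is the only set family of shape $(m^n)$ and type $\lambda$, then $\mathcal{P}$ is minimal. If $\mathcal{P}$ is a minimal set family then $\mathcal{P}$ is closed. There exist closed set families that are not minimal, and there exist minimal set families that are not the only set family of their shape and type.
   Context: Majorization: for $m$-subsets $X=\{x_1<\dots<x_m\}$, $Y=\{y_1<\dots<y_m\}$ of $\mathbf{N}=\{1,2,\dots\}$, $X\preceq Y$ if $x_i\le y_i$ for all $i$. A set family of shape $(m^n)$ is a collection of $n$ distinct $m$-subsets of $\mathbf{N}$; it is closed if whenever $Y$ belongs to it and $X\preceq Y$, then $X$ belongs to it. If $\lambda$ is a partition with largest part $a$ and conjugate $\lambda'$, a set family has type $\lambda$ if for each $i\in\{1,\dots,a\}$ exactly $\lambda'_i$ of its sets contain $i$. A set family of shape $(m^n)$ and type $\lambda$ is minimal if there is no set family of shape $(m^n)$ and type $\mu$ with $\mu\lhd\lambda$ (strictly smaller in the dominance order). *)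

theory Defs
  imports Main
begin

text \<open>Partitions are represented as functions lam :: nat => nat, where lam i is the
  i-th part for i >= 1 (lam 0 = 0 by convention); weakly decreasing, finitely many nonzero parts.\<close>
definition is_partition :: "(nat \<Rightarrow> nat) \<Rightarrow> bool" where
  "is_partition lam \<longleftrightarrow> lam 0 = 0 \<and> (\<forall>i\<ge>1. lam (Suc i) \<le> lam i)
     \<and> finite {i. lam i > 0}"

definition part_size :: "(nat \<Rightarrow> nat) \<Rightarrow> nat" where
  "part_size lam = (\<Sum>i\<in>{i. lam i > 0}. lam i)"

definition conj_part :: "(nat \<Rightarrow> nat) \<Rightarrow> nat \<Rightarrow> nat" where
  "conj_part lam j = (if j = 0 then 0 else card {i. i \<ge> 1 \<and> lam i \<ge> j})"

definition dominates_le :: "(nat \<Rightarrow> nat) \<Rightarrow> (nat \<Rightarrow> nat) \<Rightarrow> bool" where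
  "dominates_le mu lam \<longleftrightarrow> is_partition mu \<and> is_partition lam
     \<and> part_size mu = part_size lam
     \<and> (\<forall>k. (\<Sum>i\<in>{1..k}. mu i) \<le> (\<Sum>i\<in>{1..k}. lam i))"

definition dominates_less :: "(nat \<Rightarrow> nat) \<Rightarrow> (nat \<Rightarrow> nat) \<Rightarrow> bool" where
  "dominates_less mu lam \<longleftrightarrow> dominates_le mu lam \<and> mu \<noteq> lam"

definition msubset :: "nat \<Rightarrow> nat set \<Rightarrow> bool" where
  "msubset m X \<longleftrightarrow> finite X \<and> card X = m \<and> 0 \<notin> X"

definition majorized :: "nat set \<Rightarrow> nat set \<Rightarrow> bool" where
  "majorized X Y \<longleftrightarrow> finite X \<and> finite Y \<and> card X = card Y
     \<and> (\<forall>i < card X. sorted_list_of_set X ! i \<le> sorted_list_of_set Y ! i)"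

definition is_family :: "nat \<Rightarrow> nat \<Rightarrow> nat set set \<Rightarrow> bool" where
  "is_family m n P \<longleftrightarrow> m \<ge> 1 \<and> n \<ge> 1 \<and> finite P \<and> card P = n \<and> (\<forall>X\<in>P. msubset m X)"

definition closed_family :: "nat set set \<Rightarrow> bool" where
  "closed_family P \<longleftrightarrow> (\<forall>Y\<in>P. \<forall>X. msubset (card Y) X \<and> majorized X Y \<longrightarrow> X \<in> P)"

definition has_type :: "nat set set \<Rightarrow> (nat \<Rightarrow> nat) \<Rightarrow> bool" where
  "has_type P lam \<longleftrightarrow> is_partition lam \<and> (\<forall>i\<ge>1. card {X\<in>P. i \<in> X} = conj_part lam i)"

definition minimal_family :: "nat \<Rightarrow> nat \<Rightarrow> nat set set \<Rightarrow> bool" where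
  "minimal_family m n P \<longleftrightarrow> is_family m n P \<and>
     (\<exists>lam. has_type P lam \<and>
        \<not> (\<exists>Q mu. is_family m n Q \<and> has_type Q mu \<and> dominates_less mu lam))"

end

theory Submission
  imports Defs
begin

text \<open>Call the vector counting the sets of a family that contain 1, 2, ... its content: this is the
  conjugate of the type, so a minimal type is a dominance-maximal content. Replacing one set
  \<open>X\<close> by \<open>X - {i} \<union> {j}\<close> moves one unit of content from \<open>i\<close> to \<open>j\<close>, and at least
  \<open>c i - c j\<close> sets admit such a replacement.

  If the content \<open>c\<close> is dominated by that of another family, transfers with \<open>c i - c j \<ge> 2\<close>
  lead from the latter down to \<open>c\<close>; two choices in the last transfer contradict uniqueness.
  A family that is not closed admits a replacement of some \<open>y + 1\<close> by \<open>y\<close>, which raises the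
  content.

  The sets majorized by \<open>{2,5,6,8}\<close> form a closed family, whose content becomes larger when
  \<open>{1,5,6,8}, {2,5,6,8}\<close> are replaced by \<open>{1,2,7,8}, {3,4,5,6}\<close>. The 4-sets with sum below
  18 together with \<open>{1,4,5,8}, {2,3,6,7}\<close> minimize the total sum and so form a minimal family,
  of the same type as with \<open>{1,4,6,7}, {2,3,5,8}\<close> instead.\<close>

subsection \<open>Conjugate partitions and dominance\<close>

lemma partition_antimono:
  assumes "is_partition lam" "1 \<le> i" "i \<le> j"
  shows "lam j \<le> lam i"
  using assms(3)
proof (induction rule: dec_induct)
  case (step k)
  with assms have "lam (Suc k) \<le> lam k" by (auto simp: is_partition_def)
  with step show ?case by simp
qed simp

lemma down_set_eq_atLeastAtMost:
  fixes S :: "nat set"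
  assumes "finite S" "0 \<notin> S" "\<And>i j. j \<in> S \<Longrightarrow> 1 \<le> i \<Longrightarrow> i \<le> j \<Longrightarrow> i \<in> S"
  shows "S = {1..card S}"
proof (cases "S = {}")
  case False
  have "i \<in> S \<longleftrightarrow> i \<in> {1..Max S}" for i
    using assms(2) Max_in[OF assms(1) False] assms(3)[of "Max S" i] Max_ge[OF assms(1), of i]
    by (cases "i = 0") auto
  then have eq: "S = {1..Max S}" by blast
  have "card S = Max S" using arg_cong[OF eq, of card] unfolding card_atLeastAtMost by simp
  show ?thesis unfolding \<open>card S = Max S\<close> by (rule eq)
qed simp

lemma finite_conj_part_set:
  assumes "is_partition lam" "j \<ge> 1"
  shows "finite {i. i \<ge> 1 \<and> lam i \<ge> j}"
proof (rule finite_subset)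
  show "{i. i \<ge> 1 \<and> lam i \<ge> j} \<subseteq> {i. lam i > 0}" using assms(2) by auto
  show "finite {i. lam i > 0}" using assms(1) by (simp add: is_partition_def)
qed

lemma conj_part_set_eq:
  assumes "is_partition lam" "j \<ge> 1"
  shows "{i. i \<ge> 1 \<and> lam i \<ge> j} = {1..conj_part lam j}"
proof -
  have "{i. i \<ge> 1 \<and> lam i \<ge> j} = {1..card {i. i \<ge> 1 \<and> lam i \<ge> j}}"
  proof (rule down_set_eq_atLeastAtMost[OF finite_conj_part_set[OF assms]])
    fix i k assume "k \<in> {i. i \<ge> 1 \<and> lam i \<ge> j}" "1 \<le> i" "i \<le> k"
    then show "i \<in> {i. i \<ge> 1 \<and> lam i \<ge> j}"
      using partition_antimono[OF assms(1), of i k] by auto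
  qed auto
  then show ?thesis using assms(2) by (simp add: conj_part_def)
qed

text \<open>The parts \<open>lam i \<ge> j\<close> occupy an initial segment of the indices, so both
  sides say that cell \<open>(i, j)\<close> lies in the Young diagram. All later facts on conjugates
  rest on this symmetry.\<close>

lemma le_conj_part_iff:
  assumes "is_partition lam" "i \<ge> 1" "j \<ge> 1"
  shows "i \<le> conj_part lam j \<longleftrightarrow> j \<le> lam i"
proof -
  have "i \<in> {i. i \<ge> 1 \<and> lam i \<ge> j} \<longleftrightarrow> i \<in> {1..conj_part lam j}"
    by (simp only: conj_part_set_eq[OF assms(1,3)])
  then show ?thesis using assms(2) by simp
qed

lemma is_partition_conj_part:
  assumes "is_partition lam"
  shows "is_partition (conj_part lam)"
  unfolding is_partition_def
proof (intro conjI allI impI)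
  show "conj_part lam 0 = 0" by (simp add: conj_part_def)
next
  fix j :: nat assume "j \<ge> 1"
  show "conj_part lam (Suc j) \<le> conj_part lam j"
  proof (cases "conj_part lam (Suc j) = 0")
    case False
    then have "Suc j \<le> lam (conj_part lam (Suc j))"
      using le_conj_part_iff[OF assms, of "conj_part lam (Suc j)" "Suc j"] by linarith
    with False \<open>j \<ge> 1\<close> show ?thesis
      using le_conj_part_iff[OF assms, of "conj_part lam (Suc j)" j] by linarith
  qed simp
next
  have "j \<le> lam 1" if "conj_part lam j > 0" for j
    using le_conj_part_iff[OF assms, of 1 j] that by (cases "j = 0") auto
  then show "finite {j. conj_part lam j > 0}"
    by (auto intro: finite_subset[of _ "{..lam 1}"])
qed

lemma conj_part_conj_part:
  assumes "is_partition lam"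
  shows "conj_part (conj_part lam) = lam"
proof
  fix i
  show "conj_part (conj_part lam) i = lam i"
  proof (cases "i = 0")
    case True
    then show ?thesis using assms by (simp add: conj_part_def is_partition_def)
  next
    case False
    then have "{j. j \<ge> 1 \<and> conj_part lam j \<ge> i} = {1..lam i}"
      using le_conj_part_iff[OF assms, of i] by auto
    then show ?thesis using False by (simp add: conj_part_def[of "conj_part lam"])
  qed
qed

lemma partition_bound:
  assumes "is_partition lam"
  obtains N where "\<And>i. i > N \<Longrightarrow> lam i = 0"
proof -
  have fin: "finite {i. lam i > 0}" using assms by (simp add: is_partition_def)
  show ?thesis
  proof (rule that)
    fix i assume "i > Max (insert 0 {i. lam i > 0})"
    then show "lam i = 0" using Max_ge[of "insert 0 {i. lam i > 0}" i] fin by fastforce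
  qed
qed

lemma part_size_eq_sum:
  assumes "lam 0 = 0" "\<And>i. i > N \<Longrightarrow> lam i = 0"
  shows "part_size lam = (\<Sum>i\<in>{1..N}. lam i)"
  unfolding part_size_def
proof (rule sum.mono_neutral_left)
  have "i \<in> {1..N}" if "lam i > 0" for i
    using that assms(1) assms(2)[of i] by (cases "i = 0"; cases "i > N") auto
  then show "{i. lam i > 0} \<subseteq> {1..N}" by blast
qed auto

text \<open>Both sides count the cells in the first \<open>k\<close> columns of the Young diagram,
  by columns on the left and by rows on the right.\<close>

lemma sum_conj_part:
  assumes "is_partition lam" "\<And>i. i > N \<Longrightarrow> lam i = 0"
  shows "(\<Sum>j\<in>{1..k}. conj_part lam j) = (\<Sum>i\<in>{1..N}. min (lam i) k)"
proof -
  have "conj_part lam j = (\<Sum>i\<in>{1..N}. if j \<le> lam i then 1 else 0)" if "j \<ge> 1" for j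
  proof -
    have "{i. i \<ge> 1 \<and> lam i \<ge> j} = {i \<in> {1..N}. j \<le> lam i}"
      using assms(2) that by (fastforce simp: not_less[symmetric])
    then show ?thesis using that by (simp add: conj_part_def sum.If_cases Int_def)
  qed
  then have "(\<Sum>j\<in>{1..k}. conj_part lam j)
      = (\<Sum>i\<in>{1..N}. \<Sum>j\<in>{1..k}. if j \<le> lam i then 1 else 0)"
    by (subst sum.swap) simp
  also have "\<dots> = (\<Sum>i\<in>{1..N}. min (lam i) k)"
  proof (rule sum.cong[OF refl])
    fix i
    have "{1..k} \<inter> {j. j \<le> lam i} = {1..min (lam i) k}" by auto
    then show "(\<Sum>j\<in>{1..k}. if j \<le> lam i then 1 else 0) = min (lam i) k"
      by (simp add: sum.If_cases)
  qed
  finally show ?thesis .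
qed

text \<open>Column sums become row sums truncated at \<open>k\<close>. Since the totals agree and
  \<open>lam\<close> has the larger initial sums, \<open>lam\<close> has the smaller tails, and
  these govern the truncated sums.\<close>

lemma dominates_le_conj_part:
  assumes "dominates_le mu lam"
  shows "dominates_le (conj_part lam) (conj_part mu)"
proof -
  from assms have pm: "is_partition mu" and pl: "is_partition lam"
    and sz: "part_size mu = part_size lam"
    and dom: "\<And>k. (\<Sum>i\<in>{1..k}. mu i) \<le> (\<Sum>i\<in>{1..k}. lam i)"
    by (auto simp: dominates_le_def)
  obtain N1 where N1: "\<And>i. i > N1 \<Longrightarrow> mu i = 0" using partition_bound[OF pm] by blast
  obtain N2 where N2: "\<And>i. i > N2 \<Longrightarrow> lam i = 0" using partition_bound[OF pl] by blast
  define N where "N = max N1 N2"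
  have Nm: "mu i = 0" and Nl: "lam i = 0" if "i > N" for i
    using that N1 N2 by (auto simp: N_def)
  have tot: "(\<Sum>i\<in>{1..N}. mu i) = (\<Sum>i\<in>{1..N}. lam i)"
    using part_size_eq_sum[of mu N] part_size_eq_sum[of lam N] Nm Nl pm pl sz
    by (simp add: is_partition_def)
  have le: "(\<Sum>j\<in>{1..k}. conj_part lam j) \<le> (\<Sum>j\<in>{1..k}. conj_part mu j)" for k
  proof -
    \<comment> \<open>The number of parts of \<open>mu\<close> exceeding \<open>k\<close>:
      truncation changes exactly these rows of \<open>mu\<close>, so its truncated sum is
      \<open>r * k\<close> plus a tail. For \<open>lam\<close> the same cut yields only an upper
      bound.\<close>
    define r where "r = conj_part mu (Suc k)"
    have rN: "r \<le> N"
    proof (rule ccontr)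
      assume "\<not> r \<le> N"
      then show False using le_conj_part_iff[OF pm, of r "Suc k"] Nm[of r] by (simp add: r_def)
    qed
    have split: "(\<Sum>i\<in>{1..N}. f i) = (\<Sum>i\<in>{1..r}. f i) + (\<Sum>i\<in>{Suc r..N}. f i)" for f :: "nat \<Rightarrow> nat"
      using sum.ub_add_nat[of 1 r f "N - r"] rN by (simp del: sum.cl_ivl_Suc)
    have mu1: "min (mu i) k = k" if "i \<in> {1..r}" for i
      using le_conj_part_iff[OF pm, of i "Suc k"] that by (auto simp: r_def)
    have mu2: "min (mu i) k = mu i" if "i \<in> {Suc r..N}" for i
      using le_conj_part_iff[OF pm, of i "Suc k"] that by (auto simp: r_def)
    have "(\<Sum>i\<in>{1..N}. min (mu i) k) = r * k + (\<Sum>i\<in>{Suc r..N}. mu i)"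
      unfolding split[of "\<lambda>i. min (mu i) k"] using mu1 mu2 by simp
    moreover have "(\<Sum>i\<in>{1..N}. min (lam i) k) \<le> r * k + (\<Sum>i\<in>{Suc r..N}. lam i)"
    proof -
      have "(\<Sum>i\<in>{1..r}. min (lam i) k) \<le> (\<Sum>i\<in>{1..r}. k)" by (rule sum_mono) simp
      moreover have "(\<Sum>i\<in>{Suc r..N}. min (lam i) k) \<le> (\<Sum>i\<in>{Suc r..N}. lam i)"
        by (rule sum_mono) simp
      ultimately show ?thesis unfolding split[of "\<lambda>i. min (lam i) k"] by simp
    qed
    moreover have "(\<Sum>j\<in>{1..k}. conj_part mu j) = (\<Sum>i\<in>{1..N}. min (mu i) k)"
      by (rule sum_conj_part[OF pm Nm])
    moreover have "(\<Sum>j\<in>{1..k}. conj_part lam j) = (\<Sum>i\<in>{1..N}. min (lam i) k)"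
      by (rule sum_conj_part[OF pl Nl])
    ultimately show ?thesis
      using dom[of r] tot split[of mu] split[of lam] by linarith
  qed
  \<comment> \<open>Truncating at the largest part \<open>nu 1\<close> changes nothing, so the
    column sums add up to the row sums.\<close>
  have tot_conj: "part_size (conj_part nu) = (\<Sum>i\<in>{1..N}. nu i)"
    if "is_partition nu" "\<And>i. i > N \<Longrightarrow> nu i = 0" for nu
  proof -
    have bd: "nu i \<le> nu 1" if "i \<ge> 1" for i
      using partition_antimono[OF \<open>is_partition nu\<close>, of 1 i] that by simp
    have "conj_part nu j = 0" if "j > nu 1" for j
      using le_conj_part_iff[OF \<open>is_partition nu\<close>, of 1 j] that by auto
    then have "part_size (conj_part nu) = (\<Sum>j\<in>{1..nu 1}. conj_part nu j)"
      by (intro part_size_eq_sum) (auto simp: conj_part_def[of nu 0])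
    also have "\<dots> = (\<Sum>i\<in>{1..N}. min (nu i) (nu 1))"
      by (rule sum_conj_part[OF that])
    also have "\<dots> = (\<Sum>i\<in>{1..N}. nu i)" using bd by (intro sum.cong refl min_absorb1) simp
    finally show ?thesis .
  qed
  show ?thesis
    unfolding dominates_le_def
  proof (intro conjI allI)
    show "part_size (conj_part lam) = part_size (conj_part mu)"
      using tot tot_conj[OF pm Nm] tot_conj[OF pl Nl] by simp
  qed (use le is_partition_conj_part[OF pm] is_partition_conj_part[OF pl] in blast)+
qed

subsection \<open>Contents and replacements\<close>

definition content :: "nat set set \<Rightarrow> nat \<Rightarrow> nat" where
  "content P i = card {X \<in> P. i \<in> X}"

text \<open>The dominance comparison alone, free of the partition and size conditions, so that it
  applies to contents that are not decreasing.\<close>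

definition psum_le :: "(nat \<Rightarrow> nat) \<Rightarrow> (nat \<Rightarrow> nat) \<Rightarrow> bool" where
  "psum_le c d \<longleftrightarrow> (\<forall>k. (\<Sum>i\<in>{1..k}. c i) \<le> (\<Sum>i\<in>{1..k}. d i))"

definition shift :: "nat \<Rightarrow> nat \<Rightarrow> nat set \<Rightarrow> nat set" where
  "shift i j X = insert j (X - {i})"

text \<open>A potential: it drops when a replacement moves content to a smaller index, and it is the
  quantity minimized in the last example.\<close>

definition weight :: "nat set set \<Rightarrow> nat" where
  "weight P = (\<Sum>X\<in>P. \<Sum>X)"

lemma psum_le_trans: "psum_le a b \<Longrightarrow> psum_le b c \<Longrightarrow> psum_le a c"
  unfolding psum_le_def using order_trans by blast

lemma psum_le_antisym:
  assumes "psum_le c d" "psum_le d c" "c 0 = d 0"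
  shows "c = d"
proof
  fix k
  have eq: "(\<Sum>i\<in>{1..k}. c i) = (\<Sum>i\<in>{1..k}. d i)" for k
    using assms unfolding psum_le_def by (simp add: antisym)
  show "c k = d k"
  proof (cases k)
    case (Suc l)
    then show ?thesis using eq[of k] eq[of l] by simp
  qed (simp add: assms)
qed

text \<open>Double counting of the pairs \<open>(i, X)\<close> with
  \<open>i \<in> X\<close>.\<close>

lemma sum_content:
  assumes "finite P" "finite I"
  shows "(\<Sum>i\<in>I. content P i) = (\<Sum>X\<in>P. card (X \<inter> I))"
proof -
  have "content P i = (\<Sum>X\<in>P. if i \<in> X then 1 else 0)" for i
    using assms(1) by (simp add: content_def sum.If_cases Int_def)
  then have "(\<Sum>i\<in>I. content P i) = (\<Sum>X\<in>P. \<Sum>i\<in>I. if i \<in> X then 1 else 0)"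
    by (subst sum.swap) simp
  then show ?thesis
    using assms(2) by (simp add: sum.If_cases Int_def conj_commute)
qed

lemma family_finite: "is_family m n P \<Longrightarrow> finite P"
  by (simp add: is_family_def)

lemma family_memD:
  assumes "is_family m n P" "X \<in> P"
  shows "finite X" "card X = m" "0 \<notin> X"
  using assms by (auto simp: is_family_def msubset_def)

lemma family_bound:
  assumes "is_family m n P"
  obtains N where "\<And>X. X \<in> P \<Longrightarrow> X \<subseteq> {1..N}"
proof -
  have fin: "finite (\<Union>P)" using assms by (auto simp: is_family_def msubset_def)
  show ?thesis
  proof (rule that)
    fix X assume "X \<in> P"
    then have "x \<noteq> 0" "x \<le> Max (\<Union>P)" if "x \<in> X" for x
      using that family_memD(3)[OF assms, of X] Max_ge[OF fin, of x] by (auto intro!: gr0I)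
    then show "X \<subseteq> {1..Max (\<Union>P)}" by (auto simp: Suc_le_eq)
  qed
qed

lemma content_zero: "is_family m n P \<Longrightarrow> content P 0 = 0"
  by (auto simp: content_def is_family_def msubset_def)

lemma content_eq_zero:
  assumes "\<And>X. X \<in> P \<Longrightarrow> X \<subseteq> {1..N}" "i > N"
  shows "content P i = 0"
proof -
  have "{X \<in> P. i \<in> X} = {}" using assms by fastforce
  then show ?thesis unfolding content_def by (simp only: card.empty)
qed

lemma sum_content_le:
  assumes "is_family m n P"
  shows "(\<Sum>i\<in>{1..k}. content P i) \<le> m * n"
proof -
  have "(\<Sum>i\<in>{1..k}. content P i) = (\<Sum>X\<in>P. card (X \<inter> {1..k}))"
    by (rule sum_content[OF family_finite[OF assms]]) simp
  also have "\<dots> \<le> (\<Sum>X\<in>P. m)"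
    using family_memD[OF assms] by (intro sum_mono) (metis card_mono inf_le1)
  finally show ?thesis using assms by (simp add: is_family_def mult.commute)
qed

lemma sum_content_eq:
  assumes "is_family m n P" "\<And>X. X \<in> P \<Longrightarrow> X \<subseteq> {1..N}"
  shows "(\<Sum>i\<in>{1..N}. content P i) = m * n"
proof -
  have "(\<Sum>i\<in>{1..N}. content P i) = (\<Sum>X\<in>P. card (X \<inter> {1..N}))"
    by (rule sum_content[OF family_finite[OF assms(1)]]) simp
  also have "\<dots> = (\<Sum>X\<in>P. m)"
  proof (rule sum.cong[OF refl])
    fix X assume "X \<in> P"
    then show "card (X \<inter> {1..N}) = m"
      using assms(2)[of X] family_memD(2)[OF assms(1), of X] by (simp add: Int_absorb2)
  qed
  finally show ?thesis using assms(1) by (simp add: is_family_def mult.commute)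
qed

lemma part_size_content:
  assumes "is_family m n P"
  shows "part_size (content P) = m * n"
proof -
  obtain N where N: "\<And>X. X \<in> P \<Longrightarrow> X \<subseteq> {1..N}" using family_bound[OF assms] by blast
  have "part_size (content P) = (\<Sum>i\<in>{1..N}. content P i)"
    by (rule part_size_eq_sum) (use content_zero[OF assms] content_eq_zero[of P N] N in blast)+
  then show ?thesis using sum_content_eq[OF assms N] by simp
qed

lemma is_partition_content_iff:
  assumes "is_family m n P"
  shows "is_partition (content P) \<longleftrightarrow> (\<forall>i\<ge>1. content P (Suc i) \<le> content P i)"
proof -
  obtain N where N: "\<And>X. X \<in> P \<Longrightarrow> X \<subseteq> {1..N}" using family_bound[OF assms] by blast
  have "i \<le> N" if "content P i > 0" for i
    using that content_eq_zero[of P N i] N by fastforce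
  then have "finite {i. content P i > 0}"
    by (intro finite_subset[of "{i. content P i > 0}" "{..N}"]) auto
  then show ?thesis using content_zero[OF assms] by (simp add: is_partition_def)
qed

text \<open>Index 0 agrees on both sides since the members avoid 0 and \<open>conj_part\<close>
  vanishes there. As conjugation is an involution, content and type determine each other.\<close>

lemma has_type_iff:
  assumes "is_family m n P"
  shows "has_type P lam \<longleftrightarrow> is_partition lam \<and> conj_part lam = content P"
proof -
  have "(\<forall>i\<ge>1. content P i = conj_part lam i) \<longleftrightarrow> (\<forall>i. conj_part lam i = content P i)"
    using content_zero[OF assms] by (metis conj_part_def less_one not_le)
  then show ?thesis unfolding has_type_def content_def[symmetric] by (simp add: fun_eq_iff)
qed

section \<open>Exchanging sets and replacing single elements\<close>

lemma content_exchange: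
  assumes "finite P" "finite B" "A \<subseteq> P" "B \<inter> P = {}"
  shows "content (P - A \<union> B) i + content A i = content P i + content B i"
proof -
  have fA: "finite A" using assms finite_subset by blast
  have "{X \<in> P - A \<union> B. i \<in> X} = {X \<in> P - A. i \<in> X} \<union> {X \<in> B. i \<in> X}" by blast
  then have "content (P - A \<union> B) i = content (P - A) i + content B i"
    unfolding content_def using assms
    by (simp only:) (intro card_Un_disjoint, auto)
  moreover have "{X \<in> P. i \<in> X} = {X \<in> P - A. i \<in> X} \<union> {X \<in> A. i \<in> X}"
    using assms by blast
  then have "content P i = content (P - A) i + content A i"
    unfolding content_def using assms fA
    by (simp only:) (intro card_Un_disjoint, auto)
  ultimately show ?thesis by simp
qed

lemma is_family_exchange:
  assumes "is_family m n P" "finite B" "A \<subseteq> P" "B \<inter> P = {}" "card A = card B"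
    and "\<And>X. X \<in> B \<Longrightarrow> msubset m X"
  shows "is_family m n (P - A \<union> B)"
proof -
  have fP: "finite P" using assms(1) by (simp add: is_family_def)
  have "card (P - A \<union> B) = card (P - A) + card B"
    using assms fP by (intro card_Un_disjoint) auto
  also have "\<dots> = card P"
    using assms fP card_mono[OF fP assms(3)] finite_subset[OF assms(3) fP]
    by (simp add: card_Diff_subset)
  finally show ?thesis using assms by (auto simp: is_family_def)
qed

text \<open>The unchanged members contribute equally to both contents, so only the exchanged sets
  need comparison. This reduces the first example to two pairs of sets.\<close>

lemma psum_le_exchange:
  assumes "finite P" "finite B" "A \<subseteq> P" "B \<inter> P = {}" "psum_le (content A) (content B)"
  shows "psum_le (content P) (content (P - A \<union> B))"
  unfolding psum_le_def
proof
  fix k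
  have "(\<Sum>i\<in>{1..k}. content (P - A \<union> B) i) + (\<Sum>i\<in>{1..k}. content A i)
      = (\<Sum>i\<in>{1..k}. content P i) + (\<Sum>i\<in>{1..k}. content B i)"
    using content_exchange[OF assms(1-4)] by (simp add: sum.distrib[symmetric])
  moreover have "(\<Sum>i\<in>{1..k}. content A i) \<le> (\<Sum>i\<in>{1..k}. content B i)"
    using assms(5) by (simp add: psum_le_def)
  ultimately show "(\<Sum>i\<in>{1..k}. content P i) \<le> (\<Sum>i\<in>{1..k}. content (P - A \<union> B) i)"
    by linarith
qed

lemma content_singleton: "content {X} i = (if i \<in> X then 1 else 0)"
proof -
  have "{Y \<in> {X}. i \<in> Y} = (if i \<in> X then {X} else {})" by auto
  then show ?thesis unfolding content_def by simp
qed

lemma content_shift: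
  assumes "finite P" "X \<in> P" "i \<in> X" "j \<notin> X" "shift i j X \<notin> P"
  shows "content (P - {X} \<union> {shift i j X})
    = (content P)(i := content P i - 1, j := content P j + 1)"
proof
  fix k
  have "content (P - {X} \<union> {shift i j X}) k + content {X} k
      = content P k + content {shift i j X} k"
    by (rule content_exchange) (use assms in auto)
  then show "content (P - {X} \<union> {shift i j X}) k
    = ((content P)(i := content P i - 1, j := content P j + 1)) k"
    using assms by (auto simp: content_singleton shift_def)
qed

lemma content_pos:
  assumes "finite P" "X \<in> P" "i \<in> X"
  shows "content P i \<ge> 1"
  using assms unfolding content_def by (auto simp: Suc_le_eq card_gt_0_iff)

lemma is_family_shift:
  assumes "is_family m n P" "X \<in> P" "i \<in> X" "j \<notin> X" "shift i j X \<notin> P" "j \<ge> 1"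
  shows "is_family m n (P - {X} \<union> {shift i j X})"
proof (rule is_family_exchange[OF assms(1)])
  have "card X > 0" using family_memD(1)[OF assms(1,2)] assms(3) card_gt_0_iff by blast
  then show "msubset m Y" if "Y \<in> {shift i j X}" for Y
    using that family_memD[OF assms(1,2)] assms by (auto simp: msubset_def shift_def)
qed (use assms in auto)

lemma shift_inj:
  assumes "i \<in> X" "j \<notin> X" "i \<in> Y" "j \<notin> Y" "shift i j X = shift i j Y"
  shows "X = Y"
proof -
  have "Z = shift j i (shift i j Z)" if "i \<in> Z" "j \<notin> Z" for Z
    using that by (auto simp: shift_def)
  then show ?thesis using assms by metis
qed

text \<open>Members containing both \<open>i\<close> and \<open>j\<close> count equally for both
  contents. Members with \<open>i\<close> but not \<open>j\<close> whose replacement is already in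
  \<open>P\<close> inject, by \<open>shift i j\<close>, into the members with \<open>j\<close> but
  not \<open>i\<close>. Any surplus of \<open>i\<close> over \<open>j\<close> must therefore come
  from members whose replacement is new.\<close>

lemma shift_count:
  assumes "finite P" "i \<noteq> j"
  shows "content P i \<le> content P j + card {X \<in> P. i \<in> X \<and> j \<notin> X \<and> shift i j X \<notin> P}"
    (is "_ \<le> _ + card ?A")
proof -
  let ?B = "{X \<in> P. i \<in> X \<and> j \<notin> X \<and> shift i j X \<in> P}"
  let ?C = "{X \<in> P. i \<in> X \<and> j \<in> X}"
  let ?D = "{X \<in> P. j \<in> X \<and> i \<notin> X}"
  have "content P i = card (?A \<union> (?B \<union> ?C))"
    unfolding content_def by (intro arg_cong[of _ _ card]) blast
  also have "\<dots> \<le> card ?A + (card ?B + card ?C)"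
    by (rule order_trans[OF card_Un_le add_left_mono[OF card_Un_le]])
  also have "card ?B \<le> card ?D"
  proof (rule card_inj_on_le[of "shift i j"])
    show "inj_on (shift i j) ?B" by (rule inj_onI) (simp add: shift_inj[of i _ j])
    show "shift i j ` ?B \<subseteq> ?D" using assms(2) by (auto simp: shift_def)
  qed (use assms in simp)
  also have "card ?D + card ?C = content P j"
    unfolding content_def using assms(1)
    by (subst card_Un_disjoint[symmetric]) (auto intro!: arg_cong[of _ _ card])
  finally show ?thesis by simp
qed

section \<open>Unit transfers, weight and raising contents to partitions\<close>

lemma sum_transfer:
  fixes c :: "nat \<Rightarrow> nat"
  assumes "finite I" "i \<noteq> j" "c i \<ge> 1"
  shows "(\<Sum>k\<in>I. (c(i := c i - 1, j := c j + 1)) k) + (if i \<in> I then 1 else 0)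
    = (\<Sum>k\<in>I. c k) + (if j \<in> I then 1 else 0)"
proof -
  have "(c(i := c i - 1, j := c j + 1)) k + (if k = i then 1 else 0)
      = c k + (if k = j then 1 else 0)" for k
    using assms(2,3) by auto
  then have "(\<Sum>k\<in>I. (c(i := c i - 1, j := c j + 1)) k + (if k = i then 1 else 0))
      = (\<Sum>k\<in>I. c k + (if k = j then 1 else 0))"
    by (simp only:)
  then show ?thesis using assms(1) by (simp add: sum.distrib)
qed

text \<open>Moving a unit from \<open>i\<close> to the smaller index \<open>j\<close> adds one to
  the partial sums with \<open>j \<le> k < i\<close> and keeps the others.\<close>

lemma psum_le_transfer:
  assumes "1 \<le> j" "j < i" "c i \<ge> 1"
  shows "psum_le c (c(i := c i - 1, j := c j + 1))"
  unfolding psum_le_def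
proof
  fix k
  show "(\<Sum>l\<in>{1..k}. c l) \<le> (\<Sum>l\<in>{1..k}. (c(i := c i - 1, j := c j + 1)) l)"
    using sum_transfer[of "{1..k}" i j c] assms by (simp split: if_splits)
qed

lemma sum_shift:
  assumes "finite X" "i \<in> X" "j \<notin> X"
  shows "\<Sum>(shift i j X) + i = \<Sum>X + j"
  using assms by (simp add: shift_def sum.remove[of X i])

lemma weight_shift:
  assumes "is_family m n P" "X \<in> P" "i \<in> X" "j \<notin> X" "shift i j X \<notin> P"
  shows "weight (P - {X} \<union> {shift i j X}) + i = weight P + j"
proof -
  have "finite P" using assms(1) by (simp add: is_family_def)
  then have "weight (P - {X} \<union> {shift i j X}) = \<Sum>(shift i j X) + (\<Sum>Y\<in>P - {X}. \<Sum>Y)"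
    "weight P = \<Sum>X + (\<Sum>Y\<in>P - {X}. \<Sum>Y)"
    using assms by (simp_all add: weight_def sum.remove[of P X])
  then show ?thesis using sum_shift[OF family_memD(1)[OF assms(1,2)] assms(3,4)] by simp
qed

text \<open>Wherever the content increases from \<open>i\<close> to \<open>i + 1\<close>,
  \<open>shift_count\<close> yields a member in which \<open>i + 1\<close> can be replaced by
  \<open>i\<close>. This raises the content and lowers the weight by one, so the process ends, at a
  decreasing content.\<close>

lemma exists_dominating_partition:
  assumes "is_family m n Q"
  shows "\<exists>R. is_family m n R \<and> is_partition (content R) \<and> psum_le (content Q) (content R)"
  using assms
proof (induction "weight Q" arbitrary: Q rule: less_induct)
  case less
  show ?case
  proof (cases "is_partition (content Q)")
    case True
    then show ?thesis using less.prems by (auto simp: psum_le_def)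
  next
    case False
    then obtain i where i: "i \<ge> 1" "content Q i < content Q (Suc i)"
      using is_partition_content_iff[OF less.prems] not_le by blast
    then have "card {X \<in> Q. Suc i \<in> X \<and> i \<notin> X \<and> shift (Suc i) i X \<notin> Q} \<noteq> 0"
      using shift_count[OF family_finite[OF less.prems], of "Suc i" i] by simp
    then obtain X where X: "X \<in> Q" "Suc i \<in> X" "i \<notin> X" "shift (Suc i) i X \<notin> Q"
      by (metis (mono_tags, lifting) card.empty empty_Collect_eq)
    let ?Q = "Q - {X} \<union> {shift (Suc i) i X}"
    have fam: "is_family m n ?Q" by (rule is_family_shift[OF less.prems X i(1)])
    have "weight ?Q < weight Q" using weight_shift[OF less.prems X] by simp
    from less.hyps[OF this fam] obtain R where
      "is_family m n R" "is_partition (content R)" "psum_le (content ?Q) (content R)" by blast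
    moreover have "psum_le (content Q) (content ?Q)"
      unfolding content_shift[OF family_finite[OF less.prems] X] using i
      by (intro psum_le_transfer) auto
    ultimately show ?thesis using psum_le_trans by blast
  qed
qed

lemma dominates_le_content:
  assumes "is_family m n P" "is_family m n Q"
    and "is_partition (content P)" "is_partition (content Q)" "psum_le (content P) (content Q)"
  shows "dominates_le (content P) (content Q)"
  using assms by (simp add: dominates_le_def psum_le_def part_size_content)

text \<open>Conjugation reverses dominance, so minimality of the type is maximality of the content.
  The competitor may have arbitrary, not necessarily decreasing, content.\<close>
lemma minimal_family_iff:
  assumes P: "is_family m n P"
  shows "minimal_family m n P \<longleftrightarrow> is_partition (content P) \<and>
    (\<forall>Q. is_family m n Q \<and> psum_le (content P) (content Q) \<longrightarrow> content Q = content P)"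
proof (intro iffI conjI allI impI)
  assume "minimal_family m n P"
  then obtain lam where lam: "is_partition lam" "conj_part lam = content P"
    and min: "\<And>Q mu. is_family m n Q \<Longrightarrow> has_type Q mu \<Longrightarrow> \<not> dominates_less mu lam"
    using has_type_iff[OF P] unfolding minimal_family_def by auto
  show part: "is_partition (content P)" using is_partition_conj_part[OF lam(1)] lam(2) by simp
  fix Q assume Q: "is_family m n Q \<and> psum_le (content P) (content Q)"
  \<comment> \<open>Only a family with decreasing content has a type, so the competitor
    \<open>Q\<close> is first raised to such a family \<open>R\<close>.\<close>
  then obtain R where R: "is_family m n R" "is_partition (content R)"
    "psum_le (content Q) (content R)"
    using exists_dominating_partition by blast
  let ?mu = "conj_part (content R)"
  have "has_type R ?mu"
    using has_type_iff[OF R(1)] is_partition_conj_part[OF R(2)] conj_part_conj_part[OF R(2)] by simp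
  then have "\<not> dominates_less ?mu lam" using min R(1) by blast
  moreover have "dominates_le (content P) (content R)"
    using dominates_le_content[OF P R(1) part R(2)] Q R(3) psum_le_trans by blast
  then have "dominates_le ?mu lam"
    using dominates_le_conj_part conj_part_conj_part[OF lam(1)] lam(2) by fastforce
  ultimately have "?mu = lam" by (simp add: dominates_less_def)
  then have "content R = content P" using conj_part_conj_part[OF R(2)] lam(2) by simp
  \<comment> \<open>\<open>content Q\<close> lies between \<open>content P\<close> and
    \<open>content R\<close>, which coincide.\<close>
  then show "content Q = content P"
    using Q R(3) psum_le_antisym content_zero P by metis
next
  assume a: "is_partition (content P) \<and>
    (\<forall>Q. is_family m n Q \<and> psum_le (content P) (content Q) \<longrightarrow> content Q = content P)"
  let ?lam = "conj_part (content P)"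
  have "has_type P ?lam"
    using a has_type_iff[OF P] is_partition_conj_part conj_part_conj_part by simp
  moreover have "\<not> dominates_less mu ?lam" if Q: "is_family m n Q" "has_type Q mu" for Q mu
  proof
    assume less: "dominates_less mu ?lam"
    have mu: "is_partition mu" "conj_part mu = content Q" using Q has_type_iff by auto
    have "dominates_le (content P) (content Q)"
      using dominates_le_conj_part[of mu ?lam] less mu conj_part_conj_part[of "content P"] a
      by (simp add: dominates_less_def)
    then have "content Q = content P" using a Q(1) by (simp add: dominates_le_def psum_le_def)
    then have "mu = ?lam" using conj_part_conj_part[OF mu(1)] mu(2) by simp
    then show False using less by (simp add: dominates_less_def)
  qed
  ultimately show "minimal_family m n P" using P unfolding minimal_family_def by blast
qed

subsection \<open>Unique families are minimal\<close>

text \<open>Unit transfers lower the content of \<open>Q\<close> towards \<open>c\<close> while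
  keeping it above \<open>c\<close>. Each is available on at least two members, so the transfer that
  reaches \<open>c\<close> produces two families.\<close>

lemma two_families_of_content:
  assumes "is_family m n Q" "is_partition c" "part_size c = m * n"
    and "psum_le c (content Q)" "content Q \<noteq> c"
  shows "\<exists>Q1 Q2. Q1 \<noteq> Q2 \<and> is_family m n Q1 \<and> is_family m n Q2 \<and> content Q1 = c \<and> content Q2 = c"
  using assms(1,4,5)
\<comment> \<open>Truncated subtraction makes this the total deficit of \<open>content Q\<close>
  below \<open>c\<close>. A transfer lowers it by one at \<open>j\<close> and creates none at
  \<open>i\<close>, where the content stays at least \<open>c i\<close>.\<close>
proof (induction "\<Sum>i\<in>{i. c i > 0}. c i - content Q i" arbitrary: Q rule: less_induct)
  case less
  let ?d = "content Q"
  have c0: "c 0 = 0" and fin: "finite {i. c i > 0}" using assms(2) by (auto simp: is_partition_def)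
  have d0: "?d 0 = 0" by (rule content_zero[OF less.prems(1)])
  have psum: "(\<Sum>i\<in>{1..k}. c i) \<le> (\<Sum>i\<in>{1..k}. ?d i)" for k
    using less.prems(2) by (simp add: psum_le_def)
  \<comment> \<open>Otherwise \<open>?d\<close> is everywhere at least \<open>c\<close> and
    somewhere larger, so its sum exceeds the total \<open>m * n\<close> of \<open>c\<close>.\<close>
  have "\<exists>j. ?d j < c j"
  proof (rule ccontr)
    assume "\<not> (\<exists>j. ?d j < c j)"
    then have le: "c l \<le> ?d l" for l using not_le by blast
    obtain k where k: "c k \<noteq> ?d k" using less.prems(3) by (metis ext)
    obtain N where N: "\<And>i. i > N \<Longrightarrow> c i = 0" using partition_bound[OF assms(2)] by blast
    let ?M = "max N k"
    have "(\<Sum>i\<in>{1..?M}. c i) = m * n"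
      using part_size_eq_sum[of c ?M] c0 N assms(3) by simp
    moreover have "k \<in> {1..?M}" using k c0 d0 by (cases "k = 0") auto
    then have "(\<Sum>i\<in>{1..?M}. c i) < (\<Sum>i\<in>{1..?M}. ?d i)"
      using le k le_neq_implies_less[OF le k] by (intro sum_strict_mono_ex1 bexI[of _ k]) auto
    ultimately show False using sum_content_le[OF less.prems(1), of ?M] by simp
  qed
  then obtain j where j: "?d j < c j" and jmin: "\<And>l. l < j \<Longrightarrow> c l \<le> ?d l"
    using exists_least_iff[of "\<lambda>j. ?d j < c j"] not_less by blast
  have j1: "j \<ge> 1" using j c0 by (cases "j = 0") auto
  \<comment> \<open>Otherwise the deficit at \<open>j\<close> makes the partial sum of
    \<open>?d\<close> up to \<open>j\<close> smaller than that of \<open>c\<close>.\<close>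
  have "\<exists>i<j. c i < ?d i"
  proof (rule ccontr)
    assume "\<not> (\<exists>i<j. c i < ?d i)"
    then have "?d i \<le> c i" if "i \<le> j" for i
      using that j by (metis le_neq_implies_less less_imp_le not_less)
    then have "(\<Sum>i\<in>{1..j}. ?d i) < (\<Sum>i\<in>{1..j}. c i)"
      using j j1 by (intro sum_strict_mono_ex1 bexI[of _ j]) auto
    then show False using psum[of j] by simp
  qed
  then obtain i where i: "i < j" "c i < ?d i" by blast
  have i1: "i \<ge> 1" using i d0 by (cases "i = 0") auto
  have gap: "c j \<le> c i" using partition_antimono[OF assms(2) i1] i by simp
  let ?d' = "?d(i := ?d i - 1, j := ?d j + 1)"
  have psum': "psum_le c ?d'"
    unfolding psum_le_def
  proof
    fix k
    have tr: "(\<Sum>l\<in>{1..k}. ?d' l) + (if i \<in> {1..k} then 1 else 0)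
        = (\<Sum>l\<in>{1..k}. ?d l) + (if j \<in> {1..k} then 1 else 0)"
      by (rule sum_transfer) (use i in auto)
    show "(\<Sum>l\<in>{1..k}. c l) \<le> (\<Sum>l\<in>{1..k}. ?d' l)"
    proof (cases "i \<le> k \<and> k < j")
      case True
      \<comment> \<open>By minimality of \<open>j\<close>, \<open>?d\<close> is at least
        \<open>c\<close> at every index below \<open>j\<close>, and it is larger at
        \<open>i\<close>. This strictness pays for the unit removed at \<open>i\<close>.\<close>
      then have "(\<Sum>l\<in>{1..k}. c l) < (\<Sum>l\<in>{1..k}. ?d l)"
        using i i1 jmin by (intro sum_strict_mono_ex1) auto
      then show ?thesis using tr True i1 by simp
    next
      case False
      then have "(i \<in> {1..k}) = (j \<in> {1..k})" using i i1 by auto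
      then show ?thesis using tr psum[of k] by simp
    qed
  qed
  let ?A = "{X \<in> Q. i \<in> X \<and> j \<notin> X \<and> shift i j X \<notin> Q}"
  \<comment> \<open>\<open>?d i \<ge> c i + 1 \<ge> c j + 1 \<ge> ?d j + 2\<close>, using that
    \<open>c\<close> is decreasing.\<close>
  have "card ?A \<ge> 2"
    using shift_count[OF family_finite[OF less.prems(1)], of i j] i j gap by simp
  then obtain S where S: "S \<subseteq> ?A" "card S = 2" by (meson obtain_subset_with_card_n)
  then obtain X1 X2 where X: "X1 \<in> ?A" "X2 \<in> ?A" "X1 \<noteq> X2"
    unfolding card_2_iff by blast
  have step: "is_family m n (Q - {X} \<union> {shift i j X})" "content (Q - {X} \<union> {shift i j X}) = ?d'"
    if "X \<in> ?A" for X
    using that is_family_shift[OF less.prems(1) _ _ _ _ j1, of X i]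
      content_shift[OF family_finite[OF less.prems(1)], of X i j] by auto
  let ?Q1 = "Q - {X1} \<union> {shift i j X1}" and ?Q2 = "Q - {X2} \<union> {shift i j X2}"
  show ?case
  proof (cases "?d' = c")
    case True
    \<comment> \<open>The set \<open>X1\<close> separates the two families: it is removed from the
      first and kept in the second.\<close>
    have "shift i j X1 \<noteq> X1" using X(1) by (metis (no_types, lifting) mem_Collect_eq)
    then have "X1 \<notin> ?Q1" by blast
    moreover have "X1 \<in> ?Q2" using X by blast
    ultimately have "?Q1 \<noteq> ?Q2" by metis
    moreover have "content ?Q1 = c" "content ?Q2 = c"
      by (rule trans[OF step(2)[OF X(1)] True], rule trans[OF step(2)[OF X(2)] True])
    moreover note step(1)[OF X(1)] step(1)[OF X(2)]
    ultimately show ?thesis by - (intro exI[of _ ?Q1] exI[of _ ?Q2] conjI; assumption)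
  next
    case False
    have "(\<Sum>l\<in>{i. c i > 0}. c l - content ?Q1 l) < (\<Sum>l\<in>{i. c i > 0}. c l - ?d l)"
      unfolding step(2)[OF X(1)]
    proof (rule sum_strict_mono_ex1[OF fin])
      show "\<forall>l\<in>{i. c i > 0}. c l - ?d' l \<le> c l - ?d l" using i by auto
      show "\<exists>l\<in>{i. c i > 0}. c l - ?d' l < c l - ?d l" using j by (intro bexI[of _ j]) auto
    qed
    from less.hyps[OF this step(1)[OF X(1)], unfolded step(2)[OF X(1)], OF psum' False]
    show ?thesis .
  qed
qed

lemma unique_family_minimal:
  assumes "is_family m n P" "has_type P lam"
    and unique: "\<And>Q. is_family m n Q \<Longrightarrow> has_type Q lam \<Longrightarrow> Q = P"
  shows "minimal_family m n P"
proof -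
  have lam: "is_partition lam" "conj_part lam = content P"
    using has_type_iff assms(1,2) by auto
  then have part: "is_partition (content P)" using is_partition_conj_part by metis
  have "content Q = content P" if Q: "is_family m n Q" "psum_le (content P) (content Q)" for Q
  proof (rule ccontr)
    assume "content Q \<noteq> content P"
    then obtain Q1 Q2 where "Q1 \<noteq> Q2" "is_family m n Q1" "is_family m n Q2"
      "content Q1 = content P" "content Q2 = content P"
      using two_families_of_content[OF Q(1) part part_size_content[OF assms(1)] Q(2)] by blast
    then show False using unique has_type_iff lam by metis
  qed
  then show ?thesis using minimal_family_iff[OF assms(1)] part by blast
qed

subsection \<open>Minimal families are closed\<close>

text \<open>Translates the entrywise comparison of sorted lists into a comparison of the numbers of
  elements up to each threshold \<open>t\<close>.\<close>

lemma card_Int_atMost_eq: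
  fixes X :: "nat set"
  assumes "finite X"
  shows "card (X \<inter> {..t}) = card {i. i < card X \<and> sorted_list_of_set X ! i \<le> t}"
proof -
  let ?xs = "sorted_list_of_set X"
  have len: "length ?xs = card X" by simp
  have "X \<inter> {..t} = (!) ?xs ` {i. i < card X \<and> ?xs ! i \<le> t}"
  proof -
    have "X = (!) ?xs ` {..<card X}"
      using nth_image[of "card X" ?xs] assms by (simp add: lessThan_atLeast0)
    then show ?thesis by (auto simp: set_eq_iff image_iff)
  qed
  moreover have "inj_on ((!) ?xs) {i. i < card X \<and> ?xs ! i \<le> t}"
    by (rule inj_on_nth) auto
  ultimately show ?thesis by (simp add: card_image)
qed

lemma majorized_card_Int_atMost:
  assumes "majorized X Y"
  shows "card (Y \<inter> {..t}) \<le> card (X \<inter> {..t})"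
proof -
  have fin: "finite X" "finite Y" "card X = card Y" using assms by (auto simp: majorized_def)
  have "{i. i < card Y \<and> sorted_list_of_set Y ! i \<le> t}
      \<subseteq> {i. i < card X \<and> sorted_list_of_set X ! i \<le> t}"
    using assms unfolding majorized_def by (auto intro: order_trans)
  then show ?thesis
    unfolding card_Int_atMost_eq[OF fin(1)] card_Int_atMost_eq[OF fin(2)] by (intro card_mono) auto
qed

lemma majorized_trans: "majorized X Y \<Longrightarrow> majorized Y Z \<Longrightarrow> majorized X Z"
  unfolding majorized_def by (metis order_trans)

text \<open>Walks from \<open>Y\<close> down to \<open>X\<close> by replacing some
  \<open>y + 1\<close> by \<open>y\<close>, with induction on the sum of \<open>Y\<close>. The
  counting form of majorization is the invariant.\<close>

lemma mem_of_shift_closed: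
  assumes step: "\<And>Y y. Y \<in> P \<Longrightarrow> Suc y \<in> Y \<Longrightarrow> y \<notin> Y \<Longrightarrow> y \<ge> 1 \<Longrightarrow> shift (Suc y) y Y \<in> P"
    and "Y \<in> P" "finite Y" "msubset (card Y) X"
    and "\<And>t. card (Y \<inter> {..t}) \<le> card (X \<inter> {..t})"
  shows "X \<in> P"
  using assms(2-5)
proof (induction "\<Sum>Y" arbitrary: Y rule: less_induct)
  case less
  have X: "finite X" "card X = card Y" "0 \<notin> X" using less.prems(3) by (auto simp: msubset_def)
  show ?case
  proof (cases "X = Y")
    case False
    then have "\<exists>t. (t \<in> X) \<noteq> (t \<in> Y)" by blast
    \<comment> \<open>The least point of difference. It belongs to \<open>X\<close>, since otherwise
      \<open>Y\<close> would have more elements up to \<open>t\<close>.\<close>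
    then obtain t where t: "(t \<in> X) \<noteq> (t \<in> Y)"
      and below: "\<And>s. s < t \<Longrightarrow> (s \<in> X) = (s \<in> Y)"
      using exists_least_iff[of "\<lambda>t. (t \<in> X) \<noteq> (t \<in> Y)"] by blast
    have tX: "t \<in> X"
    proof (rule ccontr)
      assume "t \<notin> X"
      then have "X \<inter> {..t} \<subset> Y \<inter> {..t}" using t below by (auto simp: le_less)
      then have "card (X \<inter> {..t}) < card (Y \<inter> {..t})" by (intro psubset_card_mono) auto
      then show False using less.prems(4)[of t] by simp
    qed
    then have tY: "t \<notin> Y" using t by simp
    have "\<exists>z. z \<in> Y \<and> t < z"
    proof (rule ccontr)
      assume "\<not> (\<exists>z. z \<in> Y \<and> t < z)"
      then have "Y \<subset> X" using below tX tY by (metis linorder_neqE_nat psubsetI subsetI)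
      then show False using psubset_card_mono[OF X(1), of Y] X(2) by simp
    qed
    \<comment> \<open>The first element of \<open>Y\<close> beyond \<open>t\<close> is the one to
      lower: nothing of \<open>Y\<close> lies in between, so its predecessor is free.\<close>
    then obtain z where z: "z \<in> Y" "t < z" and zmin: "\<And>s. s < z \<Longrightarrow> t < s \<Longrightarrow> s \<notin> Y"
      using exists_least_iff[of "\<lambda>z. z \<in> Y \<and> t < z"] by blast
    then obtain y where y: "z = Suc y" by (metis Suc_pred gr_implies_not0 not_gr0)
    have ty: "t \<le> y" using z y by simp
    have yY: "y \<notin> Y" using zmin[of y] tY ty y by (cases "t = y") auto
    have y1: "y \<ge> 1" using tX X(3) ty by (cases "y = 0") auto
    let ?Y = "shift (Suc y) y Y"
    have "?Y \<in> P" using step less.prems(1) z(1) y yY y1 by blast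
    moreover have "\<Sum>?Y < \<Sum>Y" using sum_shift[of Y "Suc y" y] less.prems(2) z(1) y yY by simp
    moreover have "finite ?Y" using less.prems(2) by (simp add: shift_def)
    moreover have "card ?Y = card Y"
      using less.prems(2) z(1) y yY card_Suc_Diff1[of Y "Suc y"] by (simp add: shift_def)
    moreover have "card (?Y \<inter> {..s}) \<le> card (X \<inter> {..s})" for s
    \<comment> \<open>The count grows only at threshold \<open>y\<close>. There the new set has one
      element besides those below \<open>t\<close>, which are shared with \<open>X\<close>, and
      \<open>X\<close> has the further element \<open>t \<le> y\<close>.\<close>
    proof (cases "s = y")
      case True
      have "?Y \<inter> {..s} = insert y (X \<inter> {..<t})"
      proof (rule set_eqI)
        fix x
        show "x \<in> ?Y \<inter> {..s} \<longleftrightarrow> x \<in> insert y (X \<inter> {..<t})"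
        proof (cases "x < t")
          case True
          then show ?thesis using below[OF True] ty \<open>s = y\<close> by (auto simp: shift_def)
        next
          case False
          then have "\<not> (x \<in> Y \<and> x \<le> y)"
            using zmin[of x] tY y by (cases "x = t") auto
          then show ?thesis using False \<open>s = y\<close> by (auto simp: shift_def)
        qed
      qed
      then have "card (?Y \<inter> {..s}) \<le> Suc (card (X \<inter> {..<t}))"
        by (simp add: card_insert_if)
      also have "\<dots> = card (insert t (X \<inter> {..<t}))" by simp
      also have "\<dots> \<le> card (X \<inter> {..s})" using tX ty True by (intro card_mono) auto
      finally show ?thesis .
    next
      case False
      have "card (?Y \<inter> {..s}) \<le> card (Y \<inter> {..s})"
      proof (cases "s < y")
        case True
        then have "?Y \<inter> {..s} = Y \<inter> {..s}" by (auto simp: shift_def)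
        then show ?thesis by simp
      next
        case ge: False
        then have "?Y \<inter> {..s} = shift (Suc y) y (Y \<inter> {..s})" using False by (auto simp: shift_def)
        moreover have "Suc y \<in> Y \<inter> {..s}" using ge False z(1) y by auto
        ultimately show ?thesis
          using yY card_Suc_Diff1[of "Y \<inter> {..s}" "Suc y"] by (simp add: shift_def)
      qed
      then show ?thesis using less.prems(4)[of s] by simp
    qed
    ultimately show ?thesis using less.hyps[of ?Y] less.prems(3) by simp
  qed (use less.prems in simp)
qed

lemma minimal_family_closed:
  assumes "minimal_family m n P"
  shows "closed_family P"
proof -
  have P: "is_family m n P" using assms by (simp add: minimal_family_def)
  have max: "content Q = content P" if "is_family m n Q" "psum_le (content P) (content Q)" for Q
    using assms minimal_family_iff[OF P] that by blast
  \<comment> \<open>A missing replacement would give a family with larger content, against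
    maximality.\<close>
  have step: "shift (Suc y) y Y \<in> P" if Y: "Y \<in> P" "Suc y \<in> Y" "y \<notin> Y" and y: "y \<ge> 1" for Y y
  proof (rule ccontr)
    assume new: "shift (Suc y) y Y \<notin> P"
    let ?Q = "P - {Y} \<union> {shift (Suc y) y Y}"
    have eq: "content ?Q = (content P)(Suc y := content P (Suc y) - 1, y := content P y + 1)"
      by (rule content_shift[OF family_finite[OF P] Y new])
    have "psum_le (content P) (content ?Q)"
      unfolding eq using y content_pos[OF family_finite[OF P] Y(1,2)]
      by (intro psum_le_transfer) auto
    then have "content ?Q = content P" using max is_family_shift[OF P Y new y] by blast
    from fun_cong[OF this, of y] show False unfolding eq by simp
  qed
  show ?thesis
    unfolding closed_family_def
  proof (intro ballI allI impI)
    fix Y X assume "Y \<in> P" "msubset (card Y) X \<and> majorized X Y"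
    then show "X \<in> P"
      using mem_of_shift_closed[of P Y X] step majorized_card_Int_atMost
      by (auto simp: majorized_def)
  qed
qed

subsection \<open>Examples\<close>

lemma content_doubleton:
  assumes "X \<noteq> Y"
  shows "content {X, Y} i = (if i \<in> X then 1 else 0) + (if i \<in> Y then 1 else 0)"
  using content_exchange[of "{X}" "{Y}" "{}" i] assms
  by (simp add: content_singleton insert_commute) (simp add: content_def)

lemma closed_not_minimal:
  "\<exists>m n P. is_family m n P \<and> closed_family P \<and> \<not> minimal_family m n P"
proof -
  define P where "P = {X. msubset 4 X \<and> majorized X {2,5,6,8}}"
  define A where "A = {{1,5,6,8}, {2,5,6,8::nat}}"
  define B where "B = {{1,2,7,8}, {3,4,5,6::nat}}"
  have "closed_family P"
    unfolding closed_family_def P_def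
  proof (intro ballI allI impI)
    fix Y X assume "Y \<in> {X. msubset 4 X \<and> majorized X {2,5,6,8}}"
      and "msubset (card Y) X \<and> majorized X Y"
    then show "X \<in> {X. msubset 4 X \<and> majorized X {2,5,6,8}}"
      using majorized_trans[of X Y "{2,5,6,8}"] by (auto simp: msubset_def simp del: sorted_list_of_set_insert_remove)
  qed
  \<comment> \<open>All four elements of \<open>{2,5,6,8}\<close> are at most 8, so the counting
    form of majorization forces the same for \<open>X\<close>.\<close>
  have "X \<subseteq> {..8}" if "X \<in> P" for X
  proof -
    have X: "majorized X {2,5,6,8}" "card X = 4" "finite X" using that by (auto simp: P_def msubset_def)
    have "card ({2,5,6,8} \<inter> {..8::nat}) = 4" by simp
    then have "card X \<le> card (X \<inter> {..8})" using majorized_card_Int_atMost[OF X(1), of 8] X(2) by simp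
    then have "X \<inter> {..8} = X" using X(3) by (intro card_seteq) auto
    then show ?thesis by blast
  qed
  then have "finite P" by (intro finite_subset[of P "Pow {..8}"]) auto
  have AP: "A \<subseteq> P"
    by (auto simp: A_def P_def msubset_def majorized_def less_Suc_eq numeral_eq_Suc)
  \<comment> \<open>The third entry 7 of \<open>{1,2,7,8}\<close> exceeds 6, and the first entry 3
    of \<open>{3,4,5,6}\<close> exceeds 2.\<close>
  have BP: "B \<inter> P = {}"
    by (auto simp: B_def P_def majorized_def less_Suc_eq numeral_eq_Suc)
  have P: "is_family 4 (card P) P"
    using AP \<open>finite P\<close> by (auto simp: is_family_def P_def A_def Suc_le_eq card_gt_0_iff)
  let ?Q = "P - A \<union> B"
  have "card A = card B" by (simp add: A_def B_def card_insert_if set_eq_subset)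
  then have Q: "is_family 4 (card P) ?Q"
    by (intro is_family_exchange[OF P] AP BP) (auto simp: B_def msubset_def)
  have "psum_le (content A) (content B)"
    unfolding psum_le_def
  proof
    fix k :: nat
    \<comment> \<open>For \<open>k\<close> from 1 to 8 the partial sums are 1, 2, 2, 2, 4, 6, 6, 8
      for \<open>A\<close> and 1, 2, ..., 8 for \<open>B\<close>. Beyond 8 both stay
      constant.\<close>
    have "k = 0 \<or> k = 1 \<or> k = 2 \<or> k = 3 \<or> k = 4 \<or> k = 5 \<or> k = 6 \<or> k = 7 \<or> k \<ge> 8" by arith
    then have "(\<Sum>X\<in>A. card (X \<inter> {1..k})) \<le> (\<Sum>X\<in>B. card (X \<inter> {1..k}))"
      by (elim disjE) (simp_all add: A_def B_def set_eq_subset Int_insert_left)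
    then show "(\<Sum>i\<in>{1..k}. content A i) \<le> (\<Sum>i\<in>{1..k}. content B i)"
      by (simp add: sum_content A_def B_def)
  qed
  then have "psum_le (content P) (content ?Q)"
    by (intro psum_le_exchange AP BP \<open>finite P\<close>) (simp add: B_def)
  moreover have "content ?Q 3 \<noteq> content P 3"
  proof -
    have "content A 3 = 0" "content B 3 = 1"
      unfolding A_def B_def by (subst content_doubleton; simp add: set_eq_subset)+
    then show ?thesis using content_exchange[OF \<open>finite P\<close> _ AP BP, of 3] by (simp add: B_def)
  qed
  ultimately have "\<not> minimal_family 4 (card P) P" using minimal_family_iff[OF P] Q by metis
  then show ?thesis using P \<open>closed_family P\<close> by blast
qed

section \<open>Weight and a minimal family that is not unique\<close>

lemma sum_psum:
  fixes c :: "nat \<Rightarrow> nat"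
  shows "(\<Sum>i\<in>{1..N}. i * c i) + (\<Sum>k<N. \<Sum>i\<in>{1..k}. c i) = N * (\<Sum>i\<in>{1..N}. c i)"
  by (induction N) (auto simp: algebra_simps)

lemma weight_eq:
  assumes "is_family m n P" "\<And>X. X \<in> P \<Longrightarrow> X \<subseteq> {1..N}"
  shows "weight P = (\<Sum>i\<in>{1..N}. i * content P i)"
proof -
  have "\<Sum>X = (\<Sum>i\<in>{1..N}. if i \<in> X then i else 0)" if "X \<in> P" for X
    using assms(2)[OF that] by (simp add: sum.If_cases Int_absorb1)
  then have "weight P = (\<Sum>i\<in>{1..N}. \<Sum>X\<in>P. if i \<in> X then i else 0)"
    unfolding weight_def by (subst sum.swap) simp
  also have "\<dots> = (\<Sum>i\<in>{1..N}. i * content P i)"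
    using family_finite[OF assms(1)]
    by (simp add: sum.If_cases content_def Int_def mult.commute)
  finally show ?thesis .
qed

text \<open>By Abel summation (\<open>sum_psum\<close>) the weight is \<open>N\<close> times the
  total content minus the sum of the partial sums. The totals agree, so larger partial sums mean
  smaller weight.\<close>

lemma weight_less:
  assumes "is_family m n P" "is_family m n Q" "psum_le (content P) (content Q)"
    and "content Q \<noteq> content P"
  shows "weight Q < weight P"
proof -
  obtain N1 where N1: "\<And>X. X \<in> P \<Longrightarrow> X \<subseteq> {1..N1}" using family_bound[OF assms(1)] by blast
  obtain N2 where N2: "\<And>X. X \<in> Q \<Longrightarrow> X \<subseteq> {1..N2}" using family_bound[OF assms(2)] by blast
  define N where "N = max N1 N2"
  have NP: "X \<subseteq> {1..N}" if "X \<in> P" for X using N1[OF that] by (rule order_trans) (simp add: N_def)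
  have NQ: "X \<subseteq> {1..N}" if "X \<in> Q" for X using N2[OF that] by (rule order_trans) (simp add: N_def)
  have le: "(\<Sum>i\<in>{1..k}. content P i) \<le> (\<Sum>i\<in>{1..k}. content Q i)" for k
    using assms(3) by (simp add: psum_le_def)
  have tot: "(\<Sum>i\<in>{1..N}. content P i) = (\<Sum>i\<in>{1..N}. content Q i)"
    using sum_content_eq[OF assms(1) NP] sum_content_eq[OF assms(2) NQ] by simp
  \<comment> \<open>If all partial sums agreed, their differences would make the contents equal up
    to \<open>N\<close>, beyond which both vanish.\<close>
  have "\<exists>k<N. (\<Sum>i\<in>{1..k}. content P i) < (\<Sum>i\<in>{1..k}. content Q i)"
  proof (rule ccontr)
    assume "\<not> ?thesis"
    then have "(\<Sum>i\<in>{1..k}. content P i) = (\<Sum>i\<in>{1..k}. content Q i)" if "k \<le> N" for k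
      using le[of k] tot that by (metis le_antisym le_neq_implies_less not_less)
    note eq = this
    have "content Q k = content P k" for k
    proof (cases "k > N")
      case True
      then show ?thesis using content_eq_zero[OF NP] content_eq_zero[OF NQ] by simp
    next
      case False
      then show ?thesis
        using eq[of k] eq[of "k - 1"] content_zero[OF assms(1)] content_zero[OF assms(2)]
        by (cases k) auto
    qed
    then show False using assms(4) by blast
  qed
  then have "(\<Sum>k<N. \<Sum>i\<in>{1..k}. content P i) < (\<Sum>k<N. \<Sum>i\<in>{1..k}. content Q i)"
    using le by (intro sum_strict_mono_ex1) auto
  moreover have "weight P = (\<Sum>i\<in>{1..N}. i * content P i)"
    "weight Q = (\<Sum>i\<in>{1..N}. i * content Q i)"
    using weight_eq assms(1,2) NP NQ by blast+
  ultimately show ?thesis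
    using sum_psum[of "content P" N] sum_psum[of "content Q" N] unfolding tot by linarith
qed

text \<open>Such a family has least weight for its shape, whichever sets of sum exactly
  \<open>s\<close> it includes, while a strictly larger content would lower the weight.\<close>

lemma minimal_family_of_sum_threshold:
  assumes P: "is_family m n P"
    and le: "\<And>X. X \<in> P \<Longrightarrow> \<Sum>X \<le> s"
    and less: "\<And>X. msubset m X \<Longrightarrow> \<Sum>X < s \<Longrightarrow> X \<in> P"
  shows "minimal_family m n P"
proof -
  have fP: "finite P" using P by (rule family_finite)
  have part: "is_partition (content P)"
    unfolding is_partition_content_iff[OF P]
  proof (intro allI impI)
    fix i :: nat assume i: "i \<ge> 1"
    \<comment> \<open>The replacement has sum below \<open>s\<close> and so is already present. By
      \<open>shift_count\<close> the content is then decreasing.\<close>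
    have "shift (Suc i) i X \<in> P" if X: "X \<in> P" "Suc i \<in> X" "i \<notin> X" for X
    proof (rule ccontr)
      assume new: "shift (Suc i) i X \<notin> P"
      then have "msubset m (shift (Suc i) i X)"
        using is_family_shift[OF P X new i] by (simp add: is_family_def)
      moreover have "\<Sum>(shift (Suc i) i X) < s"
        using sum_shift[OF family_memD(1)[OF P X(1)] X(2,3)] le[OF X(1)] by simp
      ultimately show False using less new by blast
    qed
    then have "{X \<in> P. Suc i \<in> X \<and> i \<notin> X \<and> shift (Suc i) i X \<notin> P} = {}" by blast
    then show "content P (Suc i) \<le> content P i"
      using shift_count[OF fP, of "Suc i" i] by (simp only: card.empty) simp
  qed
  have "content Q = content P" if Q: "is_family m n Q" "psum_le (content P) (content Q)" for Q
  proof (rule ccontr)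
    assume "content Q \<noteq> content P"
    then have "weight Q < weight P" by (rule weight_less[OF P Q])
    moreover have fQ: "finite Q" using Q(1) by (rule family_finite)
    \<comment> \<open>Common members cancel. The remaining members are equally many on both sides,
      with sums at most \<open>s\<close> in \<open>P\<close> and at least \<open>s\<close> in
      \<open>Q\<close>.\<close>
    have "weight P = (\<Sum>X\<in>P \<inter> Q. \<Sum>X) + (\<Sum>X\<in>P - Q. \<Sum>X)"
      unfolding weight_def using fP by (rule sum.Int_Diff)
    moreover have "weight Q = (\<Sum>X\<in>P \<inter> Q. \<Sum>X) + (\<Sum>X\<in>Q - P. \<Sum>X)"
      unfolding weight_def using sum.Int_Diff[OF fQ, of _ P] by (simp add: Int_commute)
    moreover have "(\<Sum>X\<in>P - Q. \<Sum>X) \<le> card (P - Q) * s"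
      using sum_bounded_above[of "P - Q" "\<lambda>X. \<Sum>X" s] le by simp
    moreover have "card (Q - P) * s \<le> (\<Sum>X\<in>Q - P. \<Sum>X)"
    proof -
      have "s \<le> \<Sum>X" if "X \<in> Q - P" for X
        using less[of X] that Q(1) by (meson DiffE is_family_def not_less)
      then show ?thesis using sum_bounded_below[of "Q - P" s "\<lambda>X. \<Sum>X"] by simp
    qed
    moreover have "card (P - Q) = card (Q - P)"
      using P Q(1) fP fQ by (simp add: is_family_def card_Diff_subset_Int Int_commute)
    then have "card (P - Q) * s = card (Q - P) * s" by (rule arg_cong)
    ultimately show False by linarith
  qed
  then show ?thesis using minimal_family_iff[OF P] part by blast
qed

lemma minimal_not_unique:
  "\<exists>m n P lam. minimal_family m n P \<and> has_type P lam
    \<and> (\<exists>Q. is_family m n Q \<and> has_type Q lam \<and> Q \<noteq> P)"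
proof -
  \<comment> \<open>All four sets in \<open>A\<close> and \<open>B\<close> have sum 18, the
    threshold, and each of \<open>A\<close> and \<open>B\<close> partitions \<open>{1..8}\<close>.
    Hence either pair completes the sets of smaller sum with the same content.\<close>
  define A where "A = {{1,4,5,8}, {2,3,6,7::nat}}"
  define B where "B = {{1,4,6,7}, {2,3,5,8::nat}}"
  define P where "P = {X. msubset 4 X \<and> \<Sum>X < 18} \<union> A"
  have "X \<subseteq> {..18}" if "X \<in> P" for X
  proof
    fix x assume "x \<in> X"
    moreover have "finite X" "\<Sum>X \<le> 18" using that by (auto simp: P_def A_def msubset_def)
    ultimately show "x \<in> {..18}" using member_le_sum[of x X "\<lambda>x. x"] by simp
  qed
  then have "finite P" by (intro finite_subset[of P "Pow {..18}"]) auto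
  then have P: "is_family 4 (card P) P"
    by (auto simp: is_family_def P_def A_def msubset_def Suc_le_eq card_gt_0_iff)
  have min: "minimal_family 4 (card P) P"
    by (rule minimal_family_of_sum_threshold[OF P, of 18]) (auto simp: P_def A_def)
  then obtain lam where lam: "has_type P lam" by (auto simp: minimal_family_def)
  have BP: "B \<inter> P = {}" by (auto simp: B_def P_def A_def insert_eq_iff)
  have AP: "A \<subseteq> P" by (simp add: P_def)
  let ?Q = "P - A \<union> B"
  have "card A = card B" by (simp add: A_def B_def card_insert_if set_eq_subset)
  then have Q: "is_family 4 (card P) ?Q"
    by (intro is_family_exchange[OF P] AP BP) (auto simp: B_def msubset_def)
  have "content A i = content B i" for i
    unfolding A_def B_def by (subst (1 2) content_doubleton) (auto simp: set_eq_subset)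
  then have "content ?Q = content P"
    using content_exchange[OF \<open>finite P\<close> _ AP BP] by (auto simp: B_def)
  then have "has_type ?Q lam" using lam has_type_iff[OF P] has_type_iff[OF Q] by simp
  moreover have "{1,4,6,7} \<in> B" by (simp add: B_def)
  then have "?Q \<noteq> P" using BP by blast
  ultimately show ?thesis using min lam Q by blast
qed

theorem theorem1p4:
  shows "(\<forall>m n P lam. is_family m n P \<and> has_type P lam
            \<and> (\<forall>Q. is_family m n Q \<and> has_type Q lam \<longrightarrow> Q = P)
            \<longrightarrow> minimal_family m n P)
       \<and> (\<forall>m n P. minimal_family m n P \<longrightarrow> closed_family P)
       \<and> (\<exists>m n P. is_family m n P \<and> closed_family P \<and> \<not> minimal_family m n P)
       \<and> (\<exists>m n P lam. minimal_family m n P \<and> has_type P lam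
            \<and> (\<exists>Q. is_family m n Q \<and> has_type Q lam \<and> Q \<noteq> P))"
proof (intro conjI)
  show "\<forall>m n P lam. is_family m n P \<and> has_type P lam
      \<and> (\<forall>Q. is_family m n Q \<and> has_type Q lam \<longrightarrow> Q = P)
      \<longrightarrow> minimal_family m n P"
    by (intro allI impI, elim conjE, erule (1) unique_family_minimal) metis
  show "\<forall>m n P. minimal_family m n P \<longrightarrow> closed_family P"
    by (simp add: minimal_family_closed)
qed (rule closed_not_minimal, rule minimal_not_unique)

end
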